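(* Let $-\infty<a<b<\infty$. Suppose that $c_1,\ldots,c_m$ are the first $m\ge1$ terms (with indices $1,\dots,m$) of an admissible sequence for $[a,b]$. Then for every $x_0\in[a,b]$, $$\bar F_m(x_0;c_{1:m}):=\sup_{\mu\in\mathcal{F}_m(c_{1:m})}\mu([a,x_0])\qquad\text{and}\qquad\underline F_m(x_0;c_{1:m}):=\inf_{\mu\in\mathcal{F}_m(c_{1:m})}\mu([a,x_0))$$ are attained by $(m+1)$-atomic measures. Equivalently, if $X$ is any random variable on $[a,b]$ with given moments $\mathbb{E}[X^k]$ for $k=1,\ldots,m$, then sharp bounds on $F_X(x_0)=\mathbb{P}(X\le x_0)$ and on $F_X(x_0-)=\mathbb{P}(X<x_0)$ are attained by discrete random variables supported on at most $m+1$ points.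
   Context: $\mathcal{P}_{[a,b]}$ denotes the set of Borel probability measures on $[a,b]$. A real sequence $\{\varepsilon_n\}_{n\ge0}$ is admissible for $[a,b]$ if there is $\mu\in\mathcal{P}_{[a,b]}$ with $\varepsilon_n=\frac1{n!}\int_{[a,b]}(b-x)^n\,\mu(dx)$ for all $n\ge0$. For $c_{1:m}=(c_1,\dots,c_m)\in\mathbb{R}^m$, $$\mathcal{F}_m(c_{1:m}):=\left\{\mu\in\mathcal{P}_{[a,b]}:\frac1{j!}\int_{[a,b]}(b-t)^j\,\mu(dt)=c_j\text{ for }j=1,\ldots,m\right\}.$$ For a random variable $X$, $F_X$ is its cumulative distribution function and $F_X(x_0-):=\lim_{x\nearrow x_0}F_X(x)$ is the left limit of $F_X$ at $x_0$. *)

theory Defs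
  imports "HOL-Probability.Probability"
begin

definition borel_probs :: "real \<Rightarrow> real \<Rightarrow> real measure set" where
  "borel_probs a b = {\<mu>. prob_space \<mu> \<and> sets \<mu> = sets (restrict_space borel {a..b})}"

definition admissible :: "real \<Rightarrow> real \<Rightarrow> (nat \<Rightarrow> real) \<Rightarrow> bool" where
  "admissible a b \<epsilon> \<longleftrightarrow>
     (\<exists>\<mu>\<in>borel_probs a b. \<forall>n. \<epsilon> n = 1 / fact n * (\<integral>x. (b - x) ^ n \<partial>\<mu>))"

text \<open>A vector \<open>(c\<^sub>1, \<dots>, c\<^sub>m)\<close> is a function on \<open>nat\<close> of which only the values at
  \<open>1, \<dots>, m\<close> are used.\<close>

definition moment_set :: "real \<Rightarrow> real \<Rightarrow> nat \<Rightarrow> (nat \<Rightarrow> real) \<Rightarrow> real measure set" where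
  "moment_set a b m c =
     {\<mu> \<in> borel_probs a b. \<forall>j\<in>{1..m}. 1 / fact j * (\<integral>t. (b - t) ^ j \<partial>\<mu>) = c j}"

definition F_upper :: "real \<Rightarrow> real \<Rightarrow> nat \<Rightarrow> (nat \<Rightarrow> real) \<Rightarrow> real \<Rightarrow> real" where
  "F_upper a b m c x0 = (SUP \<mu>\<in>moment_set a b m c. measure \<mu> {a..x0})"

definition F_lower :: "real \<Rightarrow> real \<Rightarrow> nat \<Rightarrow> (nat \<Rightarrow> real) \<Rightarrow> real \<Rightarrow> real" where
  "F_lower a b m c x0 = (INF \<mu>\<in>moment_set a b m c. measure \<mu> {a..<x0})"

text \<open>``\<open>n\<close>-atomic'' means at most \<open>n\<close> atoms: for degenerate moments (for instance those of a
  Dirac measure at \<open>b\<close>) no measure in the moment set has more than one atom.\<close>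

definition atomic_measure :: "nat \<Rightarrow> 'a measure \<Rightarrow> bool" where
  "atomic_measure n \<mu> \<longleftrightarrow>
     (\<exists>S. finite S \<and> card S \<le> n \<and> S \<subseteq> space \<mu> \<and> (AE x in \<mu>. x \<in> S))"

definition rv_on :: "real \<Rightarrow> real \<Rightarrow> 'a measure \<Rightarrow> ('a \<Rightarrow> real) \<Rightarrow> bool" where
  "rv_on a b M X \<longleftrightarrow> prob_space M \<and> X \<in> measurable M (restrict_space borel {a..b})"

definition has_moments :: "nat \<Rightarrow> (nat \<Rightarrow> real) \<Rightarrow> 'a measure \<Rightarrow> ('a \<Rightarrow> real) \<Rightarrow> bool" where
  "has_moments m \<kappa> M X \<longleftrightarrow> (\<forall>k\<in>{1..m}. (\<integral>\<omega>. X \<omega> ^ k \<partial>M) = \<kappa> k)"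

definition cdf_rv :: "'a measure \<Rightarrow> ('a \<Rightarrow> real) \<Rightarrow> real \<Rightarrow> real" where
  "cdf_rv M X = cdf (distr M borel X)"

definition left_limit :: "(real \<Rightarrow> real) \<Rightarrow> real \<Rightarrow> real" where
  "left_limit F x0 = Lim (at_left x0) F"

definition discrete_rv :: "nat \<Rightarrow> 'a measure \<Rightarrow> ('a \<Rightarrow> real) \<Rightarrow> bool" where
  "discrete_rv n M X \<longleftrightarrow> atomic_measure n (distr M borel X)"

text \<open>The sharp bounds over all random variables on \<open>[a,b]\<close> with the given moments. HOL sets
  cannot range over sample spaces of all types, so the sample spaces here are measures on
  \<open>real\<close>, which realise every law on \<open>[a,b]\<close>.\<close>

definition sharp_upper :: "real \<Rightarrow> real \<Rightarrow> nat \<Rightarrow> (nat \<Rightarrow> real) \<Rightarrow> real \<Rightarrow> real" where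
  "sharp_upper a b m \<kappa> x0 =
     Sup {cdf_rv M X x0 | (M :: real measure) X. rv_on a b M X \<and> has_moments m \<kappa> M X}"

definition sharp_lower :: "real \<Rightarrow> real \<Rightarrow> nat \<Rightarrow> (nat \<Rightarrow> real) \<Rightarrow> real \<Rightarrow> real" where
  "sharp_lower a b m \<kappa> x0 =
     Inf {left_limit (cdf_rv M X) x0 | (M :: real measure) X.
            rv_on a b M X \<and> has_moments m \<kappa> M X}"

end

theory Submission imports Defs begin

text \<open>Every measure with the given moments is approximated by a finitely supported one with
  the same mass on a closed set \<open>A\<close> and nearly the same moments. Regarding the atoms as fixed,
  the \<open>m + 1\<close> linear constraints on the weights allow a reduction to \<open>m + 1\<close> atoms that does not
  decrease the mass of \<open>A\<close>. Atoms and weights then vary in a compact set, and along a convergent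
  subsequence the moments converge while, \<open>A\<close> being closed, mass of \<open>A\<close> is not lost in the limit.
  The lower bound is the case \<open>A = {x0..b}\<close>.\<close>

section \<open>Linear systems and the reduction of the number of atoms\<close>

text \<open>Gaussian elimination: a homogeneous system with fewer equations than unknowns has a
  nonzero solution. The induction removes one equation together with one pivot unknown
  \<open>p\<close>.\<close>

lemma nontrivial_kernel:
  fixes f :: "nat \<Rightarrow> 'a \<Rightarrow> 'b::field"
  assumes "finite S" and "n < card S"
  shows "\<exists>v. (\<exists>x\<in>S. v x \<noteq> 0) \<and> (\<forall>j<n. (\<Sum>x\<in>S. v x * f j x) = 0)"
  using assms
proof (induction n arbitrary: S f)
  case 0
  then have "S \<noteq> {}" by auto
  then show ?case by (intro exI[of _ "\<lambda>_. 1"]) auto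
next
  case (Suc n)
  show ?case
  proof (cases "\<forall>x\<in>S. f n x = 0")
    case True
    obtain v where v: "\<exists>x\<in>S. v x \<noteq> 0" "\<forall>j<n. (\<Sum>x\<in>S. v x * f j x) = 0"
      using Suc.IH[of S f] Suc.prems by auto
    then show ?thesis using True by (intro exI[of _ v]) (auto simp: less_Suc_eq)
  next
    case False
    then obtain p where p: "p \<in> S" "f n p \<noteq> 0" by auto
    define T where "T = S - {p}"
    have T: "finite T" "n < card T" "p \<notin> T" "S = insert p T"
      using Suc.prems p by (auto simp: T_def)
    \<comment> \<open>The remaining equations have \<open>p\<close> eliminated:
      \<open>f j p / f n p\<close> times equation \<open>n\<close> is subtracted from equation
      \<open>j\<close>.\<close>
    obtain v where v: "\<exists>x\<in>T. v x \<noteq> 0"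
        "\<forall>j<n. (\<Sum>x\<in>T. v x * (f j x - f j p * f n x / f n p)) = 0"
      using Suc.IH[of T "\<lambda>j x. f j x - f j p * f n x / f n p"] T by auto
    \<comment> \<open>Back substitution: equation \<open>n\<close> forces this value of the unknown
      at \<open>p\<close>.\<close>
    define r where "r = - (\<Sum>x\<in>T. v x * f n x) / f n p"
    define u where "u = (\<lambda>x. if x = p then r else v x)"
    have sum_u: "(\<Sum>x\<in>S. u x * f j x) = r * f j p + (\<Sum>x\<in>T. v x * f j x)" for j
    proof -
      have "(\<Sum>x\<in>T. u x * f j x) = (\<Sum>x\<in>T. v x * f j x)"
        using T by (intro sum.cong) (auto simp: u_def)
      then show ?thesis using T by (simp add: u_def)
    qed
    have "(\<Sum>x\<in>S. u x * f j x) = 0" if "j < Suc n" for j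
    proof (cases "j = n")
      case True
      then show ?thesis unfolding sum_u r_def using p by simp
    next
      case False
      then have "(\<Sum>x\<in>T. v x * (f j x - f j p * f n x / f n p)) = 0" using v that by simp
      moreover have "(\<Sum>x\<in>T. v x * (f j x - f j p * f n x / f n p)) =
          (\<Sum>x\<in>T. v x * f j x) - (\<Sum>x\<in>T. v x * f n x) * (f j p / f n p)"
        unfolding sum_distrib_right by (simp add: right_diff_distrib mult_ac sum_subtractf)
      ultimately have "(\<Sum>x\<in>T. v x * f j x) = (\<Sum>x\<in>T. v x * f n x) * (f j p / f n p)" by simp
      then show ?thesis unfolding sum_u r_def by simp
    qed
    moreover have "\<exists>x\<in>S. u x \<noteq> 0" using v(1) T by (auto simp: u_def)
    ultimately show ?thesis by blast
  qed
qed

text \<open>While there are more than \<open>m + 1\<close> atoms, the weights are moved along a kernel vector, in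
  the direction that does not decrease \<open>g\<close>, until one of them vanishes.\<close>

lemma basic_feasible_reduction:
  fixes f :: "nat \<Rightarrow> 'a \<Rightarrow> real" and g :: "'a \<Rightarrow> real"
  assumes "finite S" and "\<And>x. x \<in> S \<Longrightarrow> 0 \<le> w x"
  shows "\<exists>T v. T \<subseteq> S \<and> card T \<le> m + 1 \<and> (\<forall>x\<in>T. 0 \<le> v x) \<and> sum v T = sum w S \<and>
           (\<forall>j\<in>{1..m}. (\<Sum>x\<in>T. v x * f j x) = (\<Sum>x\<in>S. w x * f j x)) \<and>
           (\<Sum>x\<in>S. w x * g x) \<le> (\<Sum>x\<in>T. v x * g x)"
  using assms
proof (induction "card S" arbitrary: S w rule: less_induct)
  case less
  show ?case
  proof (cases "card S \<le> m + 1")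
    case True
    then show ?thesis using less.prems by (intro exI[of _ S] exI[of _ w]) auto
  next
    case False
    \<comment> \<open>Conservation of total mass becomes equation 0, which makes
      \<open>m + 1\<close> equations for more than \<open>m + 1\<close> unknowns.\<close>
    define F where "F = (\<lambda>j x. if j = 0 then 1 else f j x)"
    obtain d0 where d0: "\<exists>x\<in>S. d0 x \<noteq> 0" "\<forall>j<m + 1. (\<Sum>x\<in>S. d0 x * F j x) = 0"
      using nontrivial_kernel[of S "m + 1" F] less.prems(1) False by auto
    \<comment> \<open>The kernel is closed under negation, so the sign can be chosen to suit the
      objective \<open>g\<close>.\<close>
    define d where "d = (if 0 \<le> (\<Sum>x\<in>S. d0 x * g x) then d0 else (\<lambda>x. - d0 x))"
    have d: "\<exists>x\<in>S. d x \<noteq> 0" "\<And>j. j < m + 1 \<Longrightarrow> (\<Sum>x\<in>S. d x * F j x) = 0"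
        "0 \<le> (\<Sum>x\<in>S. d x * g x)"
      using d0 by (auto simp: d_def sum_negf)
    have d_sum: "sum d S = 0" using d(2)[of 0] by (simp add: F_def)
    have d_f: "(\<Sum>x\<in>S. d x * f j x) = 0" if "j \<in> {1..m}" for j
      using d(2)[of j] that by (simp add: F_def)
    define N where "N = {x \<in> S. d x < 0}"
    \<comment> \<open>A nonzero vector whose entries sum to zero has a negative entry, so some
      weight does decrease along \<open>d\<close>.\<close>
    have "N \<noteq> {}"
    proof
      assume "N = {}"
      then have "\<forall>x\<in>S. 0 \<le> d x" by (auto simp: N_def not_less)
      then have "\<forall>x\<in>S. d x = 0" using d_sum less.prems(1) by (simp add: sum_nonneg_eq_0_iff)
      then show False using d(1) by blast
    qed
    moreover have "finite N" using less.prems(1) by (simp add: N_def)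
    \<comment> \<open>Ratio test of the simplex method: among the weights that shrink along
      \<open>d\<close>, that of \<open>p\<close> reaches zero first, after the step length
      \<open>t\<close> defined next.\<close>
    ultimately obtain p where p: "p \<in> N" "\<And>x. x \<in> N \<Longrightarrow> w p / - d p \<le> w x / - d x"
      using arg_min_if_finite(1)[of N "\<lambda>x. w x / - d x"] arg_min_least[of N _ "\<lambda>x. w x / - d x"]
      by blast
    define t where "t = w p / - d p"
    have pS: "p \<in> S" "d p < 0" using p(1) by (auto simp: N_def)
    have t: "0 \<le> t" using less.prems(2)[of p] pS by (auto simp: t_def divide_nonneg_neg)
    define w' where "w' = (\<lambda>x. w x + t * d x)"
    have w'p: "w' p = 0" using pS by (simp add: w'_def t_def)
    have w'0: "0 \<le> w' x" if "x \<in> S" for x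
    proof (cases "d x < 0")
      case True
      then have "t \<le> w x / - d x" using p(2)[of x] that by (simp add: N_def t_def)
      then show ?thesis using True by (simp add: w'_def field_simps)
    next
      case False
      then show ?thesis using less.prems(2)[OF that] t by (simp add: w'_def)
    qed
    \<comment> \<open>Dropping \<open>p\<close> costs nothing because \<open>w' p = 0\<close>. One
      identity serves the mass, the constraints and the objective.\<close>
    have sum_w': "(\<Sum>x\<in>S - {p}. w' x * h x) = (\<Sum>x\<in>S. w x * h x) + t * (\<Sum>x\<in>S. d x * h x)" for h
    proof -
      have "(\<Sum>x\<in>S - {p}. w' x * h x) = (\<Sum>x\<in>S. w' x * h x)"
        using pS less.prems(1) w'p by (simp add: sum_diff1)
      then show ?thesis
        by (simp add: w'_def distrib_right sum.distrib sum_distrib_left mult.assoc)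
    qed
    have "card (S - {p}) < card S" using pS less.prems(1) by (meson card_Diff1_less)
    then obtain T v where T: "T \<subseteq> S - {p}" "card T \<le> m + 1" "\<forall>x\<in>T. 0 \<le> v x"
        "sum v T = sum w' (S - {p})"
        "\<forall>j\<in>{1..m}. (\<Sum>x\<in>T. v x * f j x) = (\<Sum>x\<in>S - {p}. w' x * f j x)"
        "(\<Sum>x\<in>S - {p}. w' x * g x) \<le> (\<Sum>x\<in>T. v x * g x)"
      using less.hyps[of "S - {p}" w'] less.prems(1) w'0 by auto
    have "sum v T = sum w S" using T(4) sum_w'[of "\<lambda>_. 1"] d_sum by simp
    moreover have "\<forall>j\<in>{1..m}. (\<Sum>x\<in>T. v x * f j x) = (\<Sum>x\<in>S. w x * f j x)"
      using T(5) sum_w' d_f by simp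
    moreover have "(\<Sum>x\<in>S. w x * g x) \<le> (\<Sum>x\<in>T. v x * g x)"
    proof -
      have "0 \<le> t * (\<Sum>x\<in>S. d x * g x)" using t d(3) by simp
      then show ?thesis using T(6) sum_w'[of g] by simp
    qed
    ultimately show ?thesis using T(1-3) by blast
  qed
qed

section \<open>Probability measures on a compact interval and their discretization\<close>

lemma borel_probsD:
  assumes "\<mu> \<in> borel_probs a b"
  shows "prob_space \<mu>" "sets \<mu> = sets (restrict_space borel {a..b})" "space \<mu> = {a..b}"
  using assms sets_eq_imp_space_eq[of \<mu> "restrict_space borel {a..b}"]
  by (auto simp: borel_probs_def)

lemma continuous_on_integrable:
  fixes f :: "real \<Rightarrow> real"
  assumes "\<mu> \<in> borel_probs a b" and "continuous_on {a..b} f"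
  shows "integrable \<mu> f"
proof -
  interpret prob_space \<mu> using borel_probsD assms by blast
  have "f \<in> borel_measurable (restrict_space borel {a..b})"
    using assms(2) by (rule borel_measurable_continuous_on_restrict)
  then have m: "f \<in> borel_measurable \<mu>"
    using measurable_cong_sets[OF borel_probsD(2)[OF assms(1)] refl] by blast
  have "compact (f ` {a..b})" using assms(2) compact_continuous_image by blast
  then obtain B where "\<forall>y\<in>f ` {a..b}. norm y \<le> B"
    using compact_imp_bounded bounded_iff by blast
  then show ?thesis
    using m borel_probsD(3)[OF assms(1)] by (intro integrable_const_bound[of _ B]) auto
qed

text \<open>The interval is cut into finitely many short cells, each split further by membership in
  \<open>A\<close>, and the mass of each cell is moved to one representative. The mass of
  \<open>A\<close> is then kept exactly, and uniform continuity controls the integrals of the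
  \<open>f j\<close>.\<close>

lemma discretization:
  fixes f :: "nat \<Rightarrow> real \<Rightarrow> real"
  assumes \<mu>: "\<mu> \<in> borel_probs a b"
    and f: "\<forall>j\<in>{1..m}. continuous_on {a..b} (f j)"
    and A: "A \<in> sets borel" and e: "0 < e"
  shows "\<exists>S w. finite S \<and> S \<subseteq> {a..b} \<and> (\<forall>x\<in>S. 0 \<le> w x) \<and> sum w S = 1 \<and>
           (\<forall>j\<in>{1..m}. \<bar>(\<Sum>x\<in>S. w x * f j x) - (\<integral>x. f j x \<partial>\<mu>)\<bar> \<le> e) \<and>
           (\<Sum>x\<in>S. w x * indicator A x) = measure \<mu> (A \<inter> {a..b})"
proof -
  interpret prob_space \<mu> using borel_probsD \<mu> by blast
  note sets[measurable_cong] = borel_probsD(2)[OF \<mu>]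
  note sp = borel_probsD(3)[OF \<mu>]
  have "\<exists>d>0. \<forall>x\<in>{a..b}. \<forall>y\<in>{a..b}. \<bar>y - x\<bar> < d \<longrightarrow> \<bar>f j y - f j x\<bar> < e" if "j \<in> {1..m}" for j
    using compact_uniformly_continuous[OF bspec[OF f that]] e
    unfolding uniformly_continuous_on_def dist_real_def by (metis compact_Icc)
  then obtain D where D: "\<And>j. j \<in> {1..m} \<Longrightarrow> 0 < D j"
      "\<And>j x y. j \<in> {1..m} \<Longrightarrow> x \<in> {a..b} \<Longrightarrow> y \<in> {a..b} \<Longrightarrow> \<bar>y - x\<bar> < D j \<Longrightarrow> \<bar>f j y - f j x\<bar> < e"
    by metis
  \<comment> \<open>The inserted 1 keeps the minimum meaningful when \<open>m = 0\<close>.\<close>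
  define d where "d = Min (insert 1 (D ` {1..m}))"
  have d0: "0 < d" using D(1) by (auto simp: d_def)
  have dD: "d \<le> D j" if "j \<in> {1..m}" for j using that unfolding d_def by (intro Min_le) auto
  \<comment> \<open>\<open>k x\<close> is the label of the cell of \<open>x\<close>. The Boolean
    component prevents the representative map \<open>q\<close> from moving points into or out of
    \<open>A\<close>.\<close>
  define k where "k = (\<lambda>x. (\<lfloor>x / d\<rfloor>, x \<in> A))"
  define r where "r = (\<lambda>c. SOME y. y \<in> {a..b} \<and> k y = c)"
  define q where "q = (\<lambda>x. r (k x))"
  have q: "q x \<in> {a..b}" "k (q x) = k x" if "x \<in> {a..b}" for x
    using someI[of "\<lambda>y. y \<in> {a..b} \<and> k y = k x" x] that by (auto simp: q_def r_def)
  have qA: "q x \<in> A \<longleftrightarrow> x \<in> A" if "x \<in> {a..b}" for x using q(2)[OF that] by (simp add: k_def)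
  have qd: "\<bar>q x - x\<bar> < d" if "x \<in> {a..b}" for x
  proof -
    have "\<lfloor>q x / d\<rfloor> = \<lfloor>x / d\<rfloor>" using q(2)[OF that] by (simp add: k_def)
    then have "\<bar>q x / d - x / d\<bar> < 1" by linarith
    moreover have "q x / d - x / d = (q x - x) / d" by (simp add: diff_divide_distrib)
    ultimately show ?thesis using d0 by (simp add: abs_divide)
  qed
  have "k ` {a..b} \<subseteq> {\<lfloor>a / d\<rfloor>..\<lfloor>b / d\<rfloor>} \<times> UNIV"
    using d0 by (auto simp: k_def intro!: floor_mono divide_right_mono)
  then have "finite (k ` {a..b})" by (rule finite_subset) auto
  then have fin: "finite (q ` {a..b})"
    unfolding q_def using finite_imageI[of "k ` {a..b}" r] by (simp add: image_image)
  have idm: "(\<lambda>x. x) \<in> \<mu> \<rightarrow>\<^sub>M borel"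
    by (subst measurable_cong_sets[OF sets refl]) (rule measurable_restrict_space1, simp)
  \<comment> \<open>The labels form a countable type, so the product of the two discrete
    sigma-algebras is again discrete. Hence \<open>q\<close> is measurable although \<open>r\<close>
    is an arbitrary choice function.\<close>
  have km: "k \<in> \<mu> \<rightarrow>\<^sub>M count_space UNIV"
  proof -
    have "(\<lambda>x. \<lfloor>x / d\<rfloor>) \<in> \<mu> \<rightarrow>\<^sub>M count_space UNIV" using idm by measurable
    moreover have "(\<lambda>x. x \<in> A) \<in> \<mu> \<rightarrow>\<^sub>M count_space UNIV" using idm A by measurable
    ultimately have "k \<in> \<mu> \<rightarrow>\<^sub>M (count_space UNIV \<Otimes>\<^sub>M count_space UNIV)"
      unfolding k_def by measurable
    then show ?thesis by (simp add: pair_measure_countable)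
  qed
  have qm: "q \<in> \<mu> \<rightarrow>\<^sub>M count_space UNIV"
    unfolding q_def using km by measurable
  define w where "w = (\<lambda>y. measure \<mu> {x \<in> space \<mu>. q x = y})"
  have ms: "{x \<in> space \<mu>. q x = y} \<in> sets \<mu>" for y using qm by measurable
  \<comment> \<open>\<open>q\<close> takes finitely many values, so this holds for arbitrary
    \<open>h\<close>; it is applied to \<open>f j\<close>, to the indicator of \<open>A\<close> and
    to the constant 1.\<close>
  have int_q: "(\<integral>x. h (q x) \<partial>\<mu>) = (\<Sum>y\<in>q ` {a..b}. w y * h y)" for h :: "real \<Rightarrow> real"
  proof -
    have "(\<integral>x. h (q x) \<partial>\<mu>) = (\<integral>x. (\<Sum>y\<in>q ` {a..b}. h y * indicator {x \<in> space \<mu>. q x = y} x) \<partial>\<mu>)"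
    proof (rule Bochner_Integration.integral_cong[OF refl])
      fix x assume x: "x \<in> space \<mu>"
      have "(\<Sum>y\<in>q ` {a..b}. h y * indicator {x \<in> space \<mu>. q x = y} x) =
          (\<Sum>y\<in>q ` {a..b}. if q x = y then h y else 0)"
        using x by (intro sum.cong) auto
      also have "\<dots> = h (q x)" using x fin sp by (simp add: sum.delta)
      finally show "h (q x) = (\<Sum>y\<in>q ` {a..b}. h y * indicator {x \<in> space \<mu>. q x = y} x)" by simp
    qed
    also have "\<dots> = (\<Sum>y\<in>q ` {a..b}. \<integral>x. h y * indicator {x \<in> space \<mu>. q x = y} x \<partial>\<mu>)"
      using ms by (intro Bochner_Integration.integral_sum integrable_mult_right integrable_real_indicator)
        (auto simp: emeasure_eq_measure)
    also have "\<dots> = (\<Sum>y\<in>q ` {a..b}. w y * h y)"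
      using ms by (intro sum.cong) (auto simp: w_def mult.commute Int_def conj_commute)
    finally show ?thesis .
  qed
  have int_fq: "integrable \<mu> (\<lambda>x. h (q x))" for h :: "real \<Rightarrow> real"
  proof -
    have "finite (h ` q ` {a..b})" using fin by simp
    then obtain B where "\<forall>y\<in>h ` q ` {a..b}. norm y \<le> B"
      using finite_imp_bounded bounded_iff by blast
    moreover have "(\<lambda>x. h (q x)) \<in> borel_measurable \<mu>"
      by (rule measurable_compose[OF qm]) simp
    ultimately show ?thesis using sp by (intro integrable_const_bound[of _ B]) auto
  qed
  have "\<bar>(\<Sum>x\<in>q ` {a..b}. w x * f j x) - (\<integral>x. f j x \<partial>\<mu>)\<bar> \<le> e" if j: "j \<in> {1..m}" for j
  proof -
    note fi = continuous_on_integrable[OF \<mu> bspec[OF f j]]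
    have "(\<Sum>x\<in>q ` {a..b}. w x * f j x) - (\<integral>x. f j x \<partial>\<mu>) = (\<integral>x. f j (q x) - f j x \<partial>\<mu>)"
      using int_q[of "f j"] int_fq[of "f j"] fi by simp
    also have "\<bar>\<dots>\<bar> \<le> (\<integral>x. \<bar>f j (q x) - f j x\<bar> \<partial>\<mu>)" by (rule integral_abs_bound)
    also have "\<dots> \<le> (\<integral>x. e \<partial>\<mu>)"
    proof (rule integral_mono)
      show "\<bar>f j (q x) - f j x\<bar> \<le> e" if "x \<in> space \<mu>" for x
        using D(2)[OF j, of x "q x"] q(1)[of x] qd[of x] dD[OF j] that sp by fastforce
    qed (use int_fq fi in auto)
    finally show ?thesis by (simp add: prob_space)
  qed
  moreover have "(\<Sum>x\<in>q ` {a..b}. w x * indicator A x) = measure \<mu> (A \<inter> {a..b})"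
  proof -
    have "(\<Sum>x\<in>q ` {a..b}. w x * indicator A x) = (\<integral>x. indicator A (q x) \<partial>\<mu>)"
      using int_q[of "indicator A"] by simp
    also have "\<dots> = (\<integral>x. indicator A x \<partial>\<mu>)"
      using qA sp by (intro Bochner_Integration.integral_cong) (auto simp: indicator_def)
    finally show ?thesis using sp by simp
  qed
  moreover have "sum w (q ` {a..b}) = 1" using int_q[of "\<lambda>_. 1"] by (simp add: prob_space)
  moreover have "q ` {a..b} \<subseteq> {a..b}" using q(1) by auto
  ultimately show ?thesis
    using fin by (intro exI[of _ "q ` {a..b}"] exI[of _ w]) (auto simp: w_def)
qed

section \<open>Limits of nodes and weights, and the measures they define\<close>

text \<open>Bolzano-Weierstrass applied to one coordinate after another, each time passing to a
  further subsequence, which preserves the limits already found.\<close>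

lemma convergent_subseq_finite:
  fixes X :: "nat \<Rightarrow> nat \<Rightarrow> 'a::heine_borel"
  assumes "\<And>i. i < k \<Longrightarrow> bounded (range (\<lambda>n. X n i))"
  shows "\<exists>l r. strict_mono (r :: nat \<Rightarrow> nat) \<and> (\<forall>i<k. (\<lambda>n. X (r n) i) \<longlonglongrightarrow> l i)"
  using assms
proof (induction k)
  case 0
  show ?case by (intro exI[of _ undefined] exI[of _ id]) (auto simp: strict_mono_def)
next
  case (Suc k)
  then obtain l r where r: "strict_mono r" "\<And>i. i < k \<Longrightarrow> (\<lambda>n. X (r n) i) \<longlonglongrightarrow> l i"
    by (metis less_Suc_eq)
  have "bounded (range (\<lambda>n. X (r n) k))"
    by (rule bounded_subset[OF Suc.prems[of k]]) auto
  then obtain z s where s: "strict_mono s" "((\<lambda>n. X (r n) k) \<circ> s) \<longlonglongrightarrow> z"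
    using bounded_imp_convergent_subsequence by blast
  have "(\<lambda>n. X ((r \<circ> s) n) i) \<longlonglongrightarrow> (l(k := z)) i" if "i < Suc k" for i
    using s(2) LIMSEQ_subseq_LIMSEQ[OF r(2) s(1)] that by (auto simp: o_def less_Suc_eq)
  then show ?case using strict_mono_o[OF r(1) s(1)] by blast
qed

text \<open>The measure is the image under \<open>x\<close> of the weights on the index set.
  Indexing the nodes allows repetitions, which matters because distinct nodes may merge in a
  limit.\<close>

lemma exists_atomic_measure:
  assumes "\<And>i. i \<in> I \<Longrightarrow> x i \<in> {a..b}" and "finite I" and "card I \<le> n"
    and w: "\<And>i. i \<in> I \<Longrightarrow> 0 \<le> w i" and "sum w I = 1"
  shows "\<exists>\<mu>\<in>borel_probs a b. atomic_measure n \<mu> \<and>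
           (\<forall>h. continuous_on {a..b} h \<longrightarrow> (\<integral>t. h t \<partial>\<mu>) = (\<Sum>i\<in>I. w i * h (x i))) \<and>
           (\<forall>A\<in>sets borel. measure \<mu> (A \<inter> {a..b}) = (\<Sum>i\<in>I. w i * indicator A (x i)))"
proof -
  define B where "B = restrict_space (borel :: real measure) {a..b}"
  define P where "P = point_measure I (\<lambda>i. ennreal (w i))"
  define \<mu> where "\<mu> = distr P B x"
  have xm: "x \<in> P \<rightarrow>\<^sub>M B"
    using assms(1) by (auto simp: P_def B_def measurable_point_measure_eq1 space_restrict_space)
  have "prob_space P"
    using assms(2) w assms(5)
    by (intro prob_spaceI) (simp add: P_def space_point_measure emeasure_point_measure_finite)
  then have \<mu>: "\<mu> \<in> borel_probs a b"
    using prob_space.prob_space_distr[OF _ xm] by (simp add: borel_probs_def \<mu>_def B_def)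
  then interpret prob_space \<mu> using borel_probsD by blast
  \<comment> \<open>Measurable integrands cover both continuous functions and indicators, so the
    formula for \<open>measure \<mu>\<close> follows from it.\<close>
  have int: "(\<integral>t. h t \<partial>\<mu>) = (\<Sum>i\<in>I. w i * h (x i))" if "h \<in> borel_measurable B" for h :: "real \<Rightarrow> real"
    unfolding \<mu>_def using xm that assms(2) w
    by (subst integral_distr) (simp_all add: P_def lebesgue_integral_point_measure_finite)
  have "measure \<mu> (A \<inter> {a..b}) = (\<Sum>i\<in>I. w i * indicator A (x i))" if "A \<in> sets borel" for A
  proof -
    have "measure \<mu> (A \<inter> {a..b}) = (\<integral>t. indicator A t \<partial>\<mu>)"
      using borel_probsD(3)[OF \<mu>] by simp
    also have "\<dots> = (\<Sum>i\<in>I. w i * indicator A (x i))"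
      using that by (intro int) (simp add: B_def measurable_restrict_space1)
    finally show ?thesis .
  qed
  moreover have "atomic_measure n \<mu>"
  proof -
    have "x ` I \<in> sets B"
      using assms(1,2) unfolding B_def by (subst sets_restrict_space_iff) (auto intro!: borel_closed finite_imp_closed)
    then have "{t \<in> space B. t \<in> x ` I} \<in> sets B" by measurable
    moreover have "AE i in P. x i \<in> x ` I" unfolding P_def AE_point_measure by blast
    ultimately have "AE t in \<mu>. t \<in> x ` I"
      unfolding \<mu>_def using AE_distr_iff[OF xm, of "\<lambda>t. t \<in> x ` I"] by blast
    moreover have "card (x ` I) \<le> n" using assms(2,3) card_image_le le_trans by blast
    ultimately show ?thesis
      unfolding atomic_measure_def using assms(1,2) borel_probsD(3)[OF \<mu>]
      by (intro exI[of _ "x ` I"]) auto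
  qed
  ultimately show ?thesis
    using \<mu> int borel_measurable_continuous_on_restrict by (intro bexI[of _ \<mu>]) (auto simp: B_def)
qed

section \<open>Existence of extremal atomic measures\<close>

text \<open>Arbitrary continuous constraint functions cover both the normalised powers of
  \<open>b - t\<close> and the plain powers of \<open>t\<close>. Closedness of \<open>A\<close>
  makes its mass upper semicontinuous, so that a maximum exists.\<close>

theorem extremal_atomic_measure:
  fixes f :: "nat \<Rightarrow> real \<Rightarrow> real" and c :: "nat \<Rightarrow> real"
    and a b :: real and m :: nat
  defines "P \<equiv> {\<mu> \<in> borel_probs a b. \<forall>j\<in>{1..m}. (\<integral>t. f j t \<partial>\<mu>) = c j}"
  assumes f: "\<forall>j\<in>{1..m}. continuous_on {a..b} (f j)"
    and A: "closed A" and "P \<noteq> {}"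
  shows "\<exists>\<mu>\<in>P. atomic_measure (m + 1) \<mu> \<and>
           (\<forall>\<nu>\<in>P. measure \<nu> (A \<inter> {a..b}) \<le> measure \<mu> (A \<inter> {a..b}))"
proof -
  have P: "\<nu> \<in> borel_probs a b" "prob_space \<nu>" if "\<nu> \<in> P" for \<nu>
    using that by (auto simp: P_def borel_probs_def)
  have "a \<le> b"
  proof -
    obtain \<nu> where "\<nu> \<in> P" using \<open>P \<noteq> {}\<close> by blast
    then have "{a..b} \<noteq> {}"
      using P[of \<nu>] prob_space.not_empty[of \<nu>] borel_probsD(3)[of \<nu> a b] by simp
    then show ?thesis by simp
  qed
  have A_borel: "A \<in> sets borel" using A by simp
  define s where "s = (SUP \<nu>\<in>P. measure \<nu> (A \<inter> {a..b}))"
  have bdd: "bdd_above ((\<lambda>\<nu>. measure \<nu> (A \<inter> {a..b})) ` P)"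
    using P(2) prob_space.prob_le_1 by (intro bdd_aboveI[of _ 1]) blast
  define e where "e = (\<lambda>n. inverse (real (Suc n)))"
  have e: "0 < e n" for n by (simp add: e_def)
  have e_lim: "e \<longlonglongrightarrow> 0" unfolding e_def by (rule LIMSEQ_inverse_real_of_nat)
  \<comment> \<open>Nodes \<open>x\<close> and weights \<open>u\<close> that meet the constraints up
    to \<open>e n\<close> and whose mass on \<open>A\<close> is at least
    \<open>s - e n\<close>.\<close>
  define approx where "approx n x u \<longleftrightarrow>
      (\<forall>i<m + 1. x i \<in> {a..b} \<and> 0 \<le> u i) \<and> (\<Sum>i<m + 1. u i) = 1 \<and>
      (\<forall>j\<in>{1..m}. \<bar>(\<Sum>i<m + 1. u i * f j (x i)) - c j\<bar> \<le> e n) \<and>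
      s - e n \<le> (\<Sum>i<m + 1. u i * indicator A (x i))" for n x u
  have "\<exists>x u. approx n x u" for n
  proof -
    obtain \<nu> where \<nu>: "\<nu> \<in> P" "s - e n < measure \<nu> (A \<inter> {a..b})"
      using less_cSUP_iff[OF \<open>P \<noteq> {}\<close> bdd, of "s - e n"] e[of n] by (auto simp: s_def)
    obtain S w where S: "finite S" "S \<subseteq> {a..b}" "\<forall>x\<in>S. 0 \<le> w x" "sum w S = 1"
        "\<forall>j\<in>{1..m}. \<bar>(\<Sum>x\<in>S. w x * f j x) - (\<integral>t. f j t \<partial>\<nu>)\<bar> \<le> e n"
        "(\<Sum>x\<in>S. w x * indicator A x) = measure \<nu> (A \<inter> {a..b})"
      using discretization[where m = m and f = f, OF P(1)[OF \<nu>(1)] f A_borel e[of n]]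
      by (elim exE conjE) (rule that)
    have \<nu>c: "\<forall>j\<in>{1..m}. (\<integral>t. f j t \<partial>\<nu>) = c j" using \<nu>(1) by (simp add: P_def)
    obtain T v where T: "T \<subseteq> S" "card T \<le> m + 1" "\<forall>x\<in>T. 0 \<le> v x" "sum v T = sum w S"
        "\<forall>j\<in>{1..m}. (\<Sum>x\<in>T. v x * f j x) = (\<Sum>x\<in>S. w x * f j x)"
        "(\<Sum>x\<in>S. w x * indicator A x) \<le> (\<Sum>x\<in>T. v x * indicator A x)"
      using basic_feasible_reduction[OF S(1), of w m f "indicator A"] S(3) by blast
    obtain h where h: "bij_betw h {..<card T} T"
      using ex_bij_betw_nat_finite[OF finite_subset[OF T(1) S(1)]] unfolding atLeast0LessThan by blast
    \<comment> \<open>Fewer than \<open>m + 1\<close> atoms are padded with copies of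
      \<open>a\<close> of weight 0, so that all stages have the same number of coordinates. The
      point \<open>a\<close> is admissible as a node because \<open>a \<le> b\<close>.\<close>
    define x where "x = (\<lambda>i. if i < card T then h i else a)"
    define u where "u = (\<lambda>i. if i < card T then v (h i) else 0)"
    have hT: "h i \<in> T" if "i < card T" for i using h that by (auto dest: bij_betwE)
    have sums: "(\<Sum>i<m + 1. u i * g (x i)) = (\<Sum>y\<in>T. v y * g y)" for g :: "real \<Rightarrow> real"
    proof -
      have "(\<Sum>i<m + 1. u i * g (x i)) = (\<Sum>i<card T. u i * g (x i))"
        using T(2) by (intro sum.mono_neutral_right) (auto simp: u_def)
      also have "\<dots> = (\<Sum>i<card T. v (h i) * g (h i))" by (simp add: u_def x_def)
      also have "\<dots> = (\<Sum>y\<in>T. v y * g y)" by (rule sum.reindex_bij_betw[OF h])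
      finally show ?thesis .
    qed
    have "(\<Sum>i<m + 1. u i) = 1" using sums[of "\<lambda>_. 1"] T(4) S(4) by simp
    moreover have "\<forall>i<m + 1. x i \<in> {a..b} \<and> 0 \<le> u i"
      using hT T(1,3) S(2) \<open>a \<le> b\<close> by (auto simp: x_def u_def subset_iff)
    moreover have "s - e n \<le> (\<Sum>i<m + 1. u i * indicator A (x i))"
      using sums[of "indicator A"] T(6) S(6) \<nu>(2) by simp
    moreover have "\<forall>j\<in>{1..m}. \<bar>(\<Sum>i<m + 1. u i * f j (x i)) - c j\<bar> \<le> e n"
      using sums T(5) S(5) \<nu>c by simp
    ultimately show ?thesis unfolding approx_def by blast
  qed
  then obtain x u where "\<And>n. approx n (x n) (u n)" by metis
  then have x: "\<And>n i. i < m + 1 \<Longrightarrow> x n i \<in> {a..b}"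
    and u: "\<And>n i. i < m + 1 \<Longrightarrow> 0 \<le> u n i" "\<And>n. (\<Sum>i<m + 1. u n i) = 1"
    and xf: "\<And>n j. j \<in> {1..m} \<Longrightarrow> \<bar>(\<Sum>i<m + 1. u n i * f j (x n i)) - c j\<bar> \<le> e n"
    and xA: "\<And>n. s - e n \<le> (\<Sum>i<m + 1. u n i * indicator A (x n i))"
    unfolding approx_def by blast+
  have u1: "u n i \<le> 1" if "i < m + 1" for n i
    using member_le_sum[of i "{..<m + 1}" "u n"] u that by simp
  \<comment> \<open>The indicator is not continuous in the node, so its values are carried as a
    third bounded coordinate and converge along the same subsequence.\<close>
  define X where "X = (\<lambda>n i. (x n i, u n i, indicator A (x n i) :: real))"
  have "bounded (range (\<lambda>n. X n i))" if "i < m + 1" for i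
  proof (rule bounded_subset)
    show "bounded ({a..b} \<times> {0..1::real} \<times> {0..1::real})" by (intro bounded_Times) auto
    show "range (\<lambda>n. X n i) \<subseteq> {a..b} \<times> {0..1} \<times> {0..1}"
      using x u(1) u1 that by (auto simp: X_def indicator_def)
  qed
  then obtain l r where r: "strict_mono r" and l: "\<And>i. i < m + 1 \<Longrightarrow> (\<lambda>n. X (r n) i) \<longlonglongrightarrow> l i"
    using convergent_subseq_finite[of "m + 1" X] by blast
  define y v g where "y = (\<lambda>i. fst (l i))" and "v = (\<lambda>i. fst (snd (l i)))" and "g = (\<lambda>i. snd (snd (l i)))"
  have lim: "(\<lambda>n. x (r n) i) \<longlonglongrightarrow> y i" "(\<lambda>n. u (r n) i) \<longlonglongrightarrow> v i"
      "(\<lambda>n. indicator A (x (r n) i)) \<longlonglongrightarrow> g i" if "i < m + 1" for i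
    using tendsto_fst[OF l[OF that]] tendsto_fst[OF tendsto_snd[OF l[OF that]]]
      tendsto_snd[OF tendsto_snd[OF l[OF that]]]
    by (simp_all add: X_def y_def v_def g_def)
  have er: "(\<lambda>n. e (r n)) \<longlonglongrightarrow> 0" using LIMSEQ_subseq_LIMSEQ[OF e_lim r] by (simp add: o_def)
  have y: "y i \<in> {a..b}" if "i < m + 1" for i
    using closed_sequentially[OF closed_atLeastAtMost _ lim(1)[OF that]] x[OF that] by blast
  have v: "0 \<le> v i" if "i < m + 1" for i
    using LIMSEQ_le_const[OF lim(2)[OF that]] u(1)[OF that] by blast
  have v1: "(\<Sum>i<m + 1. v i) = 1"
  proof -
    have "(\<lambda>n. \<Sum>i<m + 1. u (r n) i) \<longlonglongrightarrow> (\<Sum>i<m + 1. v i)"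
      by (intro tendsto_sum lim) simp
    then show ?thesis using u(2) LIMSEQ_unique[OF _ tendsto_const] by simp
  qed
  have vf: "(\<Sum>i<m + 1. v i * f j (y i)) = c j" if j: "j \<in> {1..m}" for j
  proof -
    have fl: "(\<lambda>n. f j (x (r n) i)) \<longlonglongrightarrow> f j (y i)" if "i < m + 1" for i
      using continuous_on_tendsto_compose[OF bspec[OF f j] lim(1)[OF that] y[OF that]] x[OF that] by simp
    have "(\<lambda>n. \<Sum>i<m + 1. u (r n) i * f j (x (r n) i)) \<longlonglongrightarrow> (\<Sum>i<m + 1. v i * f j (y i))"
      by (intro tendsto_sum tendsto_mult lim fl) simp_all
    moreover have "(\<lambda>n. (\<Sum>i<m + 1. u (r n) i * f j (x (r n) i)) - c j) \<longlonglongrightarrow> 0"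
      by (rule Lim_null_comparison[OF always_eventually er]) (simp only: real_norm_def xf[OF j] simp_thms)
    ultimately show ?thesis by (rule LIMSEQ_unique[OF _ LIM_zero_cancel])
  qed
  text \<open>\<open>g i\<close> can be smaller than the indicator, when nodes outside \<open>A\<close> converge into \<open>A\<close>.\<close>
  have gA: "g i \<le> indicator A (y i)" if i: "i < m + 1" for i
  proof (cases "y i \<in> A")
    case True
    then show ?thesis using LIMSEQ_le_const2[OF lim(3)[OF i], of 1] by (auto simp: indicator_def)
  next
    case False
    \<comment> \<open>The complement of \<open>A\<close> is open, so nodes converging to a point
      outside \<open>A\<close> eventually stay outside.\<close>
    then have "eventually (\<lambda>n. x (r n) i \<in> - A) sequentially"
      using A lim(1)[OF i] by (intro topological_tendstoD) (auto simp: open_Compl)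
    then have "(\<lambda>n. indicator A (x (r n) i) :: real) \<longlonglongrightarrow> 0"
      by (intro tendsto_eventually) (auto elim: eventually_mono)
    then show ?thesis using lim(3)[OF i] LIMSEQ_unique False by fastforce
  qed
  have vA: "s \<le> (\<Sum>i<m + 1. v i * indicator A (y i))"
  proof -
    have "(\<lambda>n. \<Sum>i<m + 1. u (r n) i * indicator A (x (r n) i)) \<longlonglongrightarrow> (\<Sum>i<m + 1. v i * g i)"
      by (intro tendsto_sum tendsto_mult lim) simp_all
    moreover have "(\<lambda>n. s - e (r n)) \<longlonglongrightarrow> s - 0" by (intro tendsto_intros er)
    ultimately have "s - 0 \<le> (\<Sum>i<m + 1. v i * g i)" using xA by (blast intro: LIMSEQ_le)
    also have "\<dots> \<le> (\<Sum>i<m + 1. v i * indicator A (y i))"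
      by (intro sum_mono mult_left_mono gA v) simp_all
    finally show ?thesis by simp
  qed
  obtain \<mu> where \<mu>: "\<mu> \<in> borel_probs a b" "atomic_measure (m + 1) \<mu>"
      "\<And>h. continuous_on {a..b} h \<Longrightarrow> (\<integral>t. h t \<partial>\<mu>) = (\<Sum>i<m + 1. v i * h (y i))"
      "measure \<mu> (A \<inter> {a..b}) = (\<Sum>i<m + 1. v i * indicator A (y i))"
    using exists_atomic_measure[of "{..<m + 1}" y a b "m + 1" v] y v v1 A_borel by auto
  have "\<mu> \<in> P" using \<mu>(1,3) f vf by (simp add: P_def)
  \<comment> \<open>The mass that \<mu> gives to \<open>A\<close> is at least the supremum
    \<open>s\<close>, which bounds the mass given by \<nu>.\<close>
  moreover have "measure \<nu> (A \<inter> {a..b}) \<le> measure \<mu> (A \<inter> {a..b})" if "\<nu> \<in> P" for \<nu>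
    using cSUP_upper[OF that bdd] vA \<mu>(4) by (simp add: s_def)
  ultimately show ?thesis using \<mu>(2) by blast
qed

text \<open>Turns minimising the mass of \<open>{a..<x0}\<close> into maximising that of the closed
  set \<open>{x0..b}\<close>.\<close>

lemma measure_half_open:
  assumes "\<mu> \<in> borel_probs a b" and "x0 \<in> {a..b}"
  shows "measure \<mu> {a..<x0} = 1 - measure \<mu> {x0..b}"
proof -
  interpret prob_space \<mu> by (rule borel_probsD(1)[OF assms(1)])
  have "{x0..b} \<in> sets \<mu>"
    unfolding borel_probsD(2)[OF assms(1)] using assms(2) by (auto simp: sets_restrict_space_iff)
  then have "measure \<mu> (space \<mu> - {x0..b}) = 1 - measure \<mu> {x0..b}" by (rule prob_compl)
  moreover have "space \<mu> - {x0..b} = {a..<x0}"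
    unfolding borel_probsD(3)[OF assms(1)] using assms(2) by auto
  ultimately show ?thesis by (simp only:)
qed

corollary extremal_atomic_measures_cdf:
  fixes f :: "nat \<Rightarrow> real \<Rightarrow> real" and c :: "nat \<Rightarrow> real"
    and a b :: real and m :: nat
  defines "P \<equiv> {\<mu> \<in> borel_probs a b. \<forall>j\<in>{1..m}. (\<integral>t. f j t \<partial>\<mu>) = c j}"
  assumes f: "\<forall>j\<in>{1..m}. continuous_on {a..b} (f j)"
    and x0: "x0 \<in> {a..b}" and "P \<noteq> {}"
  shows "\<exists>\<mu>\<in>P. atomic_measure (m + 1) \<mu> \<and> (\<forall>\<nu>\<in>P. measure \<nu> {a..x0} \<le> measure \<mu> {a..x0})"
    and "\<exists>\<mu>\<in>P. atomic_measure (m + 1) \<mu> \<and> (\<forall>\<nu>\<in>P. measure \<mu> {a..<x0} \<le> measure \<nu> {a..<x0})"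
proof -
  note extremal = extremal_atomic_measure[where m = m and c = c and f = f and a = a and b = b, folded P_def]
  have "{a..x0} \<inter> {a..b} = {a..x0}" "{x0..b} \<inter> {a..b} = {x0..b}" using x0 by auto
  then show "\<exists>\<mu>\<in>P. atomic_measure (m + 1) \<mu> \<and> (\<forall>\<nu>\<in>P. measure \<nu> {a..x0} \<le> measure \<mu> {a..x0})"
    and "\<exists>\<mu>\<in>P. atomic_measure (m + 1) \<mu> \<and> (\<forall>\<nu>\<in>P. measure \<mu> {a..<x0} \<le> measure \<nu> {a..<x0})"
    using extremal[of "{a..x0}"] extremal[of "{x0..b}"] assms(2,4) measure_half_open[OF _ x0]
    by (auto simp: P_def)
qed

section \<open>Random variables and their laws\<close>

lemma cdf_rv_eq:
  assumes "rv_on a b M X"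
  shows "cdf_rv M X t = measure M {\<omega> \<in> space M. X \<omega> \<le> t}"
    and "left_limit (cdf_rv M X) t = measure M {\<omega> \<in> space M. X \<omega> < t}"
proof -
  interpret prob_space M using assms by (simp add: rv_on_def)
  have X: "X \<in> borel_measurable M"
    using assms by (auto simp: rv_on_def measurable_restrict_space2_iff)
  interpret D: real_distribution "distr M borel X" using X by (rule real_distribution_distr)
  have set_eq: "X -` {..t} \<inter> space M = {\<omega> \<in> space M. X \<omega> \<le> t}"
      "X -` {..<t} \<inter> space M = {\<omega> \<in> space M. X \<omega> < t}" by auto
  show "cdf_rv M X t = measure M {\<omega> \<in> space M. X \<omega> \<le> t}"
    using X set_eq by (simp add: cdf_rv_def cdf_def measure_distr)
  have "left_limit (cdf_rv M X) t = measure (distr M borel X) {..<t}"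
    unfolding left_limit_def cdf_rv_def by (intro tendsto_Lim D.cdf_at_left) simp
  then show "left_limit (cdf_rv M X) t = measure M {\<omega> \<in> space M. X \<omega> < t}"
    using X set_eq by (simp add: measure_distr)
qed

text \<open>Moments, distribution function and its left limit depend only on the law, so questions
  about random variables reduce to measures in \<open>borel_probs a b\<close>.\<close>

lemma rv_on_law:
  assumes rv: "rv_on a b M X" and t: "t \<in> {a..b}"
  defines "\<mu> \<equiv> distr M (restrict_space borel {a..b}) X"
  shows "\<mu> \<in> borel_probs a b"
    and "(\<integral>\<omega>. X \<omega> ^ k \<partial>M) = (\<integral>x. x ^ k \<partial>\<mu>)"
    and "cdf_rv M X t = measure \<mu> {a..t}"
    and "left_limit (cdf_rv M X) t = measure \<mu> {a..<t}"
proof -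
  have M: "prob_space M" and X: "X \<in> M \<rightarrow>\<^sub>M restrict_space borel {a..b}"
    using assms by (auto simp: rv_on_def)
  show "\<mu> \<in> borel_probs a b"
    using prob_space.prob_space_distr[OF M X] by (simp add: \<mu>_def borel_probs_def)
  show "(\<integral>\<omega>. X \<omega> ^ k \<partial>M) = (\<integral>x. x ^ k \<partial>\<mu>)"
    unfolding \<mu>_def by (subst integral_distr[OF X]) (auto intro: measurable_restrict_space1)
  have ran: "X \<omega> \<in> {a..b}" if "\<omega> \<in> space M" for \<omega>
    using measurable_space[OF X that] by (simp add: space_restrict_space)
  have s: "{a..t} \<in> sets (restrict_space borel {a..b})" "{a..<t} \<in> sets (restrict_space borel {a..b})"
    using t by (auto simp: sets_restrict_space_iff)
  have "X -` {a..t} \<inter> space M = {\<omega> \<in> space M. X \<omega> \<le> t}"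
    "X -` {a..<t} \<inter> space M = {\<omega> \<in> space M. X \<omega> < t}" using ran by auto
  then show "cdf_rv M X t = measure \<mu> {a..t}" "left_limit (cdf_rv M X) t = measure \<mu> {a..<t}"
    using s X cdf_rv_eq[OF assms(1)] by (simp_all add: \<mu>_def measure_distr)
qed

text \<open>The converse passage: a measure on the interval is the law of the identity on itself,
  which realises it on a sample space over \<open>real\<close>.\<close>

lemma rv_on_id:
  assumes \<mu>: "\<mu> \<in> borel_probs a b" and t: "t \<in> {a..b}"
  shows "rv_on a b \<mu> (\<lambda>x. x)"
    and "cdf_rv \<mu> (\<lambda>x. x) t = measure \<mu> {a..t}"
    and "left_limit (cdf_rv \<mu> (\<lambda>x. x)) t = measure \<mu> {a..<t}"
    and "atomic_measure n \<mu> \<Longrightarrow> discrete_rv n \<mu> (\<lambda>x. x)"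
proof -
  show rv: "rv_on a b \<mu> (\<lambda>x. x)"
    using borel_probsD[OF \<mu>] by (auto simp: rv_on_def intro: measurable_ident_sets)
  have "{x \<in> space \<mu>. x \<le> t} = {a..t}" "{x \<in> space \<mu>. x < t} = {a..<t}"
    using t borel_probsD(3)[OF \<mu>] by auto
  then show "cdf_rv \<mu> (\<lambda>x. x) t = measure \<mu> {a..t}"
    "left_limit (cdf_rv \<mu> (\<lambda>x. x)) t = measure \<mu> {a..<t}"
    using cdf_rv_eq[OF rv] by simp_all
  assume "atomic_measure n \<mu>"
  then obtain S where S: "finite S" "card S \<le> n" "AE x in \<mu>. x \<in> S"
    by (auto simp: atomic_measure_def)
  have "(\<lambda>x. x) \<in> borel_measurable \<mu>"
    using rv by (auto simp: rv_on_def measurable_restrict_space2_iff)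
  \<comment> \<open>\<open>discrete_rv\<close> refers to the law on all of \<open>real\<close>; the
    finite set \<open>S\<close> is closed, hence Borel there.\<close>
  then have "AE x in distr \<mu> borel (\<lambda>x. x). x \<in> S"
    using S by (subst AE_distr_iff) (auto intro!: borel_closed finite_imp_closed)
  then show "discrete_rv n \<mu> (\<lambda>x. x)"
    using S unfolding discrete_rv_def atomic_measure_def by (intro exI[of _ S]) auto
qed

section \<open>Attained bounds for measures and for random variables\<close>

text \<open>The sample space of \<open>X\<close> has any type, whereas the sharp bounds range over
  measures on \<open>real\<close>. The two are compared through the law of \<open>X\<close> on the
  interval.\<close>

theorem corollary7:
  fixes a b :: real and m :: nat and c \<epsilon> :: "nat \<Rightarrow> real" and x0 :: real
  assumes "a < b" and "1 \<le> m"
    and "admissible a b \<epsilon>" and "\<forall>j\<in>{1..m}. c j = \<epsilon> j"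
    and "x0 \<in> {a..b}"
  shows "(\<exists>\<mu>\<in>moment_set a b m c.
            atomic_measure (m + 1) \<mu> \<and> measure \<mu> {a..x0} = F_upper a b m c x0) \<and>
         (\<exists>\<mu>\<in>moment_set a b m c.
            atomic_measure (m + 1) \<mu> \<and> measure \<mu> {a..<x0} = F_lower a b m c x0) \<and>
         (\<forall>(M :: 'a measure) X \<kappa>. rv_on a b M X \<and> has_moments m \<kappa> M X \<longrightarrow>
            cdf_rv M X x0 = measure M {\<omega> \<in> space M. X \<omega> \<le> x0} \<and>
            left_limit (cdf_rv M X) x0 = measure M {\<omega> \<in> space M. X \<omega> < x0} \<and>
            cdf_rv M X x0 \<le> sharp_upper a b m \<kappa> x0 \<and>
            (\<exists>(N :: real measure) Y. rv_on a b N Y \<and> has_moments m \<kappa> N Y \<and>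
               discrete_rv (m + 1) N Y \<and> cdf_rv N Y x0 = sharp_upper a b m \<kappa> x0) \<and>
            sharp_lower a b m \<kappa> x0 \<le> left_limit (cdf_rv M X) x0 \<and>
            (\<exists>(N :: real measure) Y. rv_on a b N Y \<and> has_moments m \<kappa> N Y \<and>
               discrete_rv (m + 1) N Y \<and>
               left_limit (cdf_rv N Y) x0 = sharp_lower a b m \<kappa> x0))"
proof (intro conjI allI impI)
  note x0 = \<open>x0 \<in> {a..b}\<close>
  define f where "f = (\<lambda>(j::nat) t. 1 / fact j * (b - t) ^ j)"
  have ms: "moment_set a b m c = {\<mu> \<in> borel_probs a b. \<forall>j\<in>{1..m}. (\<integral>t. f j t \<partial>\<mu>) = c j}"
    by (simp add: moment_set_def f_def)
  have cont: "continuous_on {a..b} (f j)" for j unfolding f_def by (intro continuous_intros)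
  \<comment> \<open>The measure that witnesses admissibility lies in the moment set.\<close>
  have ne: "moment_set a b m c \<noteq> {}"
    using assms(3,4) by (auto simp: admissible_def moment_set_def)
  note extremal = extremal_atomic_measures_cdf[OF ballI[OF cont] x0 ne[unfolded ms], folded ms]
  obtain \<mu> where \<mu>: "\<mu> \<in> moment_set a b m c" "atomic_measure (m + 1) \<mu>"
      "\<forall>\<nu>\<in>moment_set a b m c. measure \<nu> {a..x0} \<le> measure \<mu> {a..x0}"
    using extremal(1) by blast
  have "F_upper a b m c x0 = measure \<mu> {a..x0}"
    unfolding F_upper_def using \<mu> by (intro cSup_eq_maximum) auto
  then show "\<exists>\<mu>\<in>moment_set a b m c.
      atomic_measure (m + 1) \<mu> \<and> measure \<mu> {a..x0} = F_upper a b m c x0" using \<mu> by auto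
  obtain \<nu> where \<nu>: "\<nu> \<in> moment_set a b m c" "atomic_measure (m + 1) \<nu>"
      "\<forall>\<mu>\<in>moment_set a b m c. measure \<nu> {a..<x0} \<le> measure \<mu> {a..<x0}"
    using extremal(2) by blast
  have "F_lower a b m c x0 = measure \<nu> {a..<x0}"
    unfolding F_lower_def using \<nu> by (intro cInf_eq_minimum) auto
  then show "\<exists>\<mu>\<in>moment_set a b m c.
      atomic_measure (m + 1) \<mu> \<and> measure \<mu> {a..<x0} = F_lower a b m c x0" using \<nu> by auto
next
  note x0 = \<open>x0 \<in> {a..b}\<close>
  fix M :: "'a measure" and X \<kappa>
  assume MX: "rv_on a b M X \<and> has_moments m \<kappa> M X"
  then show "cdf_rv M X x0 = measure M {\<omega> \<in> space M. X \<omega> \<le> x0}"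
    and "left_limit (cdf_rv M X) x0 = measure M {\<omega> \<in> space M. X \<omega> < x0}"
    using cdf_rv_eq by blast+
  define P where "P = {\<mu> \<in> borel_probs a b. \<forall>j\<in>{1..m}. (\<integral>t. t ^ j \<partial>\<mu>) = \<kappa> j}"
  have law: "\<exists>\<mu>\<in>P. cdf_rv N Y x0 = measure \<mu> {a..x0} \<and>
      left_limit (cdf_rv N Y) x0 = measure \<mu> {a..<x0}"
    if "rv_on a b N Y" "has_moments m \<kappa> N Y" for N :: "'b measure" and Y
    using rv_on_law[OF that(1) x0] that(2)
    by (intro bexI[of _ "distr N (restrict_space borel {a..b}) Y"]) (auto simp: P_def has_moments_def)
  have id: "rv_on a b \<mu> (\<lambda>x. x)" "has_moments m \<kappa> \<mu> (\<lambda>x. x)"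
      "cdf_rv \<mu> (\<lambda>x. x) x0 = measure \<mu> {a..x0}"
      "left_limit (cdf_rv \<mu> (\<lambda>x. x)) x0 = measure \<mu> {a..<x0}"
      "atomic_measure (m + 1) \<mu> \<Longrightarrow> discrete_rv (m + 1) \<mu> (\<lambda>x. x)" if "\<mu> \<in> P" for \<mu>
    using rv_on_id[of \<mu> a b x0] that x0 by (auto simp: P_def has_moments_def)
  \<comment> \<open>The law of \<open>X\<close> itself: it shows that \<open>P\<close> is nonempty
    and places \<open>X\<close> between the two bounds.\<close>
  obtain \<mu>0 where \<mu>0: "\<mu>0 \<in> P" "cdf_rv M X x0 = measure \<mu>0 {a..x0}"
      "left_limit (cdf_rv M X) x0 = measure \<mu>0 {a..<x0}"
    using rv_on_law[of a b M X, OF _ x0] MX by (auto simp: P_def has_moments_def)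
  have cont: "continuous_on {a..b} (\<lambda>t. t ^ j)" for j :: nat by (intro continuous_intros)
  have ne: "P \<noteq> {}" using \<mu>0 by blast
  note extremal = extremal_atomic_measures_cdf[OF ballI[OF cont] x0 ne[unfolded P_def], folded P_def]
  obtain \<mu> where \<mu>: "\<mu> \<in> P" "atomic_measure (m + 1) \<mu>" "\<forall>\<nu>\<in>P. measure \<nu> {a..x0} \<le> measure \<mu> {a..x0}"
    using extremal(1) by blast
  have up: "sharp_upper a b m \<kappa> x0 = measure \<mu> {a..x0}"
    unfolding sharp_upper_def
  proof (rule cSup_eq_maximum)
    show "measure \<mu> {a..x0} \<in> {cdf_rv M X x0 | (M :: real measure) X. rv_on a b M X \<and> has_moments m \<kappa> M X}"
      \<comment> \<open>The maximum is a competing value, realised by the identity on the extremal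
        measure.\<close>
      using id[OF \<mu>(1)] by force
    show "z \<le> measure \<mu> {a..x0}"
      if "z \<in> {cdf_rv M X x0 | (M :: real measure) X. rv_on a b M X \<and> has_moments m \<kappa> M X}" for z
      using that law \<mu>(3) by fastforce
  qed
  show "cdf_rv M X x0 \<le> sharp_upper a b m \<kappa> x0" using up \<mu>(3) \<mu>0 by simp
  show "\<exists>(N :: real measure) Y. rv_on a b N Y \<and> has_moments m \<kappa> N Y \<and>
      discrete_rv (m + 1) N Y \<and> cdf_rv N Y x0 = sharp_upper a b m \<kappa> x0"
    using up id[OF \<mu>(1)] \<mu>(2) by metis
  obtain \<nu> where \<nu>: "\<nu> \<in> P" "atomic_measure (m + 1) \<nu>" "\<forall>\<mu>\<in>P. measure \<nu> {a..<x0} \<le> measure \<mu> {a..<x0}"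
    using extremal(2) by blast
  have lo: "sharp_lower a b m \<kappa> x0 = measure \<nu> {a..<x0}"
    unfolding sharp_lower_def
  proof (rule cInf_eq_minimum)
    show "measure \<nu> {a..<x0} \<in> {left_limit (cdf_rv M X) x0 | (M :: real measure) X.
        rv_on a b M X \<and> has_moments m \<kappa> M X}"
      using id[OF \<nu>(1)] by force
    show "measure \<nu> {a..<x0} \<le> z"
      if "z \<in> {left_limit (cdf_rv M X) x0 | (M :: real measure) X.
        rv_on a b M X \<and> has_moments m \<kappa> M X}" for z
      using that law \<nu>(3) by fastforce
  qed
  show "sharp_lower a b m \<kappa> x0 \<le> left_limit (cdf_rv M X) x0" using lo \<nu>(3) \<mu>0 by simp
  show "\<exists>(N :: real measure) Y. rv_on a b N Y \<and> has_moments m \<kappa> N Y \<and>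
      discrete_rv (m + 1) N Y \<and> left_limit (cdf_rv N Y) x0 = sharp_lower a b m \<kappa> x0"
    using lo id[OF \<nu>(1)] \<nu>(2) by metis
qed

end
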